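(* Let $A$ be a semiring, let $B$ be a non-empty subset of $A$ and let $n\ge 2$ be an integer. Suppose that every element of $B$ is of finite decomposition in $B$, and that every element of $nB$ is of finite $n$-partition in $B$. Then: (1) The partially ordered set $(\mathcal{R}_d(2^B)_n,\supset)$ contains minimal elements (that is, elements minimal with respect to inclusion). (2) $\mathcal{R}_d(2^B)_n\cap\mathcal{F}_{ir}(A)_n\neq\emptyset$. Moreover, an element $C\in\mathcal{R}_d(2^B)_n$ is minimal (with respect to inclusion in $\mathcal{R}_d(2^B)_n$) if and only if $C\in\mathcal{R}_d(2^B)_n\cap\mathcal{F}_{ir}(A)_n$.
   Context: A semiring $(A,+,\cdot)$ is associative, with a zero element $0$; multiplication need not be commutative and a multiplicative identity $1$ need not exist (if $1\in A$ then $0\ne 1$). For a non-empty $C\subset A$ and $n\ge 1$, $nC=\{c_1+\cdots+c_n: c_1,\dots,c_n\in C\}$ is the $n$-fold sumset. For non-empty subsets $B,C\subset A$ and $n\ge 2$, write $B\gtrdot\Rightarrow_n C$ if $B\supset C$, $nB=nC$, and the following property holds: (FP) for every $b\in B$ there are $k\ge1$ and $c_1,\dots,c_k\in C$ with $b=c_1\cdots c_k$. For non-empty $B\subset A$, $\mathcal{R}_d(2^B)_n=\{C: C \text{ is a non-empty subset of } B \text{ and } B\gtrdot\Rightarrow_n C\}$ (it always contains $B$). A non-empty subset $B$ is called $n$-th sum-factor irreducible if $\mathcal{R}_d(2^B)_n=\{B\}$, and $\mathcal{F}_{ir}(A)_n$ denotes the set of all $n$-th sum-factor irreducible subsets of $A$.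 Finite decomposition: an orderly decomposition of $a\in A$ in $B$ is an expression $a=b_1\cdots b_k$ with $k\ge1$, $b_1,\dots,b_k\in B$; two orderly decompositions $b_1\cdots b_k$ and $c_1\cdots c_h$ are the same iff $k=h$ and $b_i=c_i$ for all $i$. The element $a$ is of finite decomposition in $B$ if it has at most finitely many distinct orderly decompositions in $B$. Finite $n$-partition: a partition of $a\in A$ in $B$ is a finite sequence of distinct elements $b_1,\dots,b_r\in B$ together with positive integers $k_1,\dots,k_r$ such that $a=k_1b_1+\cdots+k_rb_r$; its length is $k_1+\cdots+k_r$, and a partition of length $k$ is called a $k$-partition. Two partitions $(b_i,k_i)_{i\le r}$ and $(b_i',k_i')_{i\le r'}$ are the same if there is a bijection $\varphi:\{1,\dots,r\}\to\{1,\dots,r'\}$ with $b_i=b'_{\varphi(i)}$ and $k_i=k'_{\varphi(i)}$ for all $i$. The element $a$ is of finite $k$-partition in $B$ if it has at most finitely many distinct $k$-partitions in $B$. *)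

theory Defs
  imports Main
begin

definition nfold_sumset :: "nat \<Rightarrow> 'a::comm_monoid_add set \<Rightarrow> 'a set" where
  "nfold_sumset n C = {\<Sum>i<n. c i | c. \<forall>i<n. c i \<in> C}"

(* The product of a non-empty list. As there need not be a multiplicative identity,
   prod_list is not available; the value on the empty list is irrelevant. *)
definition list_product :: "'a::semigroup_mult list \<Rightarrow> 'a" where
  "list_product xs = foldl (*) (hd xs) (tl xs)"

definition orderly_decompositions :: "'a::semigroup_mult set \<Rightarrow> 'a \<Rightarrow> 'a list set" where
  "orderly_decompositions B a = {bs. bs \<noteq> [] \<and> set bs \<subseteq> B \<and> a = list_product bs}"

definition finite_decomposition :: "'a::semigroup_mult set \<Rightarrow> 'a \<Rightarrow> bool" where
  "finite_decomposition B a \<longleftrightarrow> finite (orderly_decompositions B a)"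

(* The list [(b1,k1),...,(br,kr)] represents the expression k1 b1 + ... + kr br of length k;
   the inner sum over {..<m} is the multiple m b. *)
definition partitions :: "nat \<Rightarrow> 'a::comm_monoid_add set \<Rightarrow> 'a \<Rightarrow> ('a \<times> nat) list set" where
  "partitions k B a = {ps. ps \<noteq> [] \<and> distinct (map fst ps) \<and>
     (\<forall>(b, m) \<in> set ps. b \<in> B \<and> 0 < m) \<and>
     a = (\<Sum>(b, m)\<leftarrow>ps. \<Sum>j<m. b) \<and>
     k = (\<Sum>(b, m)\<leftarrow>ps. m)}"

definition same_partition :: "(('a \<times> nat) list \<times> ('a \<times> nat) list) set" where
  "same_partition = {(ps, qs). \<exists>\<phi>. bij_betw \<phi> {..<length ps} {..<length qs} \<and>
     (\<forall>i<length ps. fst (ps ! i) = fst (qs ! \<phi> i) \<and> snd (ps ! i) = snd (qs ! \<phi> i))}"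

(* Distinct partitions are counted up to reordering, i.e. as classes of same_partition. *)
definition finite_partition :: "nat \<Rightarrow> 'a::comm_monoid_add set \<Rightarrow> 'a \<Rightarrow> bool" where
  "finite_partition k B a \<longleftrightarrow> finite (partitions k B a // same_partition)"

definition factor_property :: "'a::semigroup_mult set \<Rightarrow> 'a set \<Rightarrow> bool" where
  "factor_property B C \<longleftrightarrow> (\<forall>b\<in>B. \<exists>cs. cs \<noteq> [] \<and> set cs \<subseteq> C \<and> b = list_product cs)"

definition sum_factor_reduces :: "nat \<Rightarrow> 'a::semiring_0 set \<Rightarrow> 'a set \<Rightarrow> bool" where
  "sum_factor_reduces n B C \<longleftrightarrow>
     B \<noteq> {} \<and> C \<noteq> {} \<and> C \<subseteq> B \<and> nfold_sumset n B = nfold_sumset n C \<and> factor_property B C"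

definition reductions :: "nat \<Rightarrow> 'a::semiring_0 set \<Rightarrow> 'a set set" where
  "reductions n B = {C. C \<noteq> {} \<and> C \<subseteq> B \<and> sum_factor_reduces n B C}"

definition irreducibles :: "nat \<Rightarrow> 'a::semiring_0 set set" where
  "irreducibles n = {B. B \<noteq> {} \<and> reductions n B = {B}}"

definition inclusion_minimal :: "'a set set \<Rightarrow> 'a set \<Rightarrow> bool" where
  "inclusion_minimal F C \<longleftrightarrow> C \<in> F \<and> (\<forall>D\<in>F. D \<subseteq> C \<longrightarrow> D = C)"

end

theory Submission
  imports Defs
begin

text \<open>
  The reductions of \<^term>\<open>B\<close> are closed under intersections of non-empty chains, so Zorn's lemma
  yields a minimal one. Indeed an element has only finitely many decompositions (and only finitely
  many supports of sums of length \<^term>\<open>n\<close>), and every member of the chain contains one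
  of them; as the members are nested, one and the same decomposition works for all of them.
  Minimality agrees with irreducibility because a reduction of a reduction is a reduction.
\<close>

section \<open>Finite families of sets along a chain\<close>

lemma finite_subset_of_chain_Inter:
  fixes \<C> S :: "'a set set"
  assumes "finite S" "\<C> \<noteq> {}"
    and chain: "\<And>C D. C \<in> \<C> \<Longrightarrow> D \<in> \<C> \<Longrightarrow> C \<subseteq> D \<or> D \<subseteq> C"
    and ex: "\<And>C. C \<in> \<C> \<Longrightarrow> \<exists>s\<in>S. s \<subseteq> C"
  shows "\<exists>s\<in>S. s \<subseteq> \<Inter>\<C>"
proof (rule ccontr)
  assume neg: "\<not> ?thesis"
  \<comment> \<open>Each \<open>s\<close> fails to lie in some member of the chain and in all
    smaller members. Of two nested members, the smaller one inherits both failures, so finitely many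
    failures occur in a single member. For \<open>T = S\<close> this contradicts
    \<open>ex\<close>.\<close>
  have "\<exists>C\<in>\<C>. \<forall>s\<in>T. \<not> s \<subseteq> C" if "finite T" "T \<subseteq> S" for T
    using that
  proof (induction T rule: finite_induct)
    case empty
    then show ?case using assms(2) by auto
  next
    case (insert s T)
    obtain C where C: "C \<in> \<C>" "\<forall>s\<in>T. \<not> s \<subseteq> C" using insert by auto
    obtain D where D: "D \<in> \<C>" "\<not> s \<subseteq> D" using insert.prems neg by blast
    show ?case
      using chain[OF C(1) D(1)]
    proof
      assume "C \<subseteq> D"
      with C D show ?thesis by (intro bexI[of _ C]) auto
    next
      assume "D \<subseteq> C"
      with C D show ?thesis by (intro bexI[of _ D]) auto
    qed
  qed
  from this[OF assms(1) order_refl] ex show False by blast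
qed

section \<open>Products of lists and the factor property\<close>

lemma list_product_Cons_mult:
  "list_product ((a * b) # xs) = a * list_product (b # xs)"
  by (induction xs arbitrary: b) (auto simp: list_product_def mult.assoc)

lemma list_product_append:
  assumes "xs \<noteq> []" "ys \<noteq> []"
  shows "list_product (xs @ ys) = list_product xs * list_product ys"
proof -
  obtain y zs where "ys = y # zs" using assms(2) by (cases ys) auto
  \<comment> \<open>\<open>foldl\<close> starts from the left, so running through \<open>xs\<close>
    leaves \<open>list_product xs\<close> as accumulator, and \<open>y\<close> is multiplied onto it
    next. Associativity then moves this accumulator out of the remaining product.\<close>
  moreover have "list_product (xs @ y # zs) = list_product ((list_product xs * y) # zs)"
    using assms(1) by (simp add: list_product_def)
  ultimately show ?thesis by (simp add: list_product_Cons_mult)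
qed

text \<open>Replace every entry by a factorization of it and concatenate. This is what makes the
  factor property transitive.\<close>

lemma list_product_factors:
  assumes "factor_property B C" "xs \<noteq> []" "set xs \<subseteq> B"
  shows "\<exists>ys. ys \<noteq> [] \<and> set ys \<subseteq> C \<and> list_product xs = list_product ys"
  using assms(2,3)
proof (induction xs rule: list_nonempty_induct)
  case (single x)
  then show ?case using assms(1) by (simp add: factor_property_def list_product_def)
next
  case (cons x xs)
  obtain ys where ys: "ys \<noteq> []" "set ys \<subseteq> C" "list_product xs = list_product ys"
    using cons by auto
  obtain zs where zs: "zs \<noteq> []" "set zs \<subseteq> C" "x = list_product zs"
    using cons.prems assms(1) by (auto simp: factor_property_def)
  have "list_product (x # xs) = list_product [x] * list_product xs"
    using list_product_append[of "[x]" xs] cons.hyps by simp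
  also have "\<dots> = list_product (zs @ ys)"
    using ys zs list_product_append[of zs ys] by (simp add: list_product_def)
  finally show ?case using ys zs by (intro exI[of _ "zs @ ys"]) auto
qed

lemma factor_property_trans:
  assumes "factor_property B C" "factor_property C D"
  shows "factor_property B D"
  unfolding factor_property_def
proof
  fix b assume "b \<in> B"
  then obtain cs where "cs \<noteq> []" "set cs \<subseteq> C" "b = list_product cs"
    using assms(1) by (auto simp: factor_property_def)
  then show "\<exists>ds. ds \<noteq> [] \<and> set ds \<subseteq> D \<and> b = list_product ds"
    using list_product_factors[OF assms(2)] by simp
qed

lemma factor_property_refl: "factor_property B B"
  unfolding factor_property_def
proof
  fix b assume "b \<in> B"
  then show "\<exists>cs. cs \<noteq> [] \<and> set cs \<subseteq> B \<and> b = list_product cs"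
    by (intro exI[of _ "[b]"]) (simp add: list_product_def)
qed

section \<open>Minimal reductions and irreducible sets\<close>

lemma mem_reductions_iff:
  "C \<in> reductions n B \<longleftrightarrow>
     C \<noteq> {} \<and> C \<subseteq> B \<and> nfold_sumset n B = nfold_sumset n C \<and> factor_property B C"
  by (auto simp: reductions_def sum_factor_reduces_def)

lemma self_mem_reductions: "B \<noteq> {} \<Longrightarrow> B \<in> reductions n B"
  by (simp add: mem_reductions_iff factor_property_refl)

text \<open>One direction is transitivity of the factor property. For the other, \<open>C\<close>
  and \<open>D\<close> both have the sumset of \<open>B\<close>, and factorizations over
  \<open>D\<close> of all elements of \<open>B\<close> include those for the subset
  \<open>C\<close>. Hence the reductions of \<open>B\<close> lying below \<open>C\<close> depend on
  \<open>C\<close> alone, which turns minimality into irreducibility.\<close>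

lemma mem_reductions_within_reduction_iff:
  assumes "C \<in> reductions n B"
  shows "D \<in> reductions n C \<longleftrightarrow> D \<in> reductions n B \<and> D \<subseteq> C"
proof
  assume "D \<in> reductions n C"
  with assms show "D \<in> reductions n B \<and> D \<subseteq> C"
    by (auto simp: mem_reductions_iff intro: factor_property_trans)
next
  assume "D \<in> reductions n B \<and> D \<subseteq> C"
  with assms show "D \<in> reductions n C"
    by (auto simp: mem_reductions_iff factor_property_def)
qed

lemma inclusion_minimal_reductions_iff:
  assumes "C \<in> reductions n B"
  shows "inclusion_minimal (reductions n B) C \<longleftrightarrow> C \<in> irreducibles n"
proof -
  have "C \<noteq> {}" using assms by (simp add: mem_reductions_iff)
  have "inclusion_minimal (reductions n B) C \<longleftrightarrow> (\<forall>D\<in>reductions n C. D = C)"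
    unfolding inclusion_minimal_def mem_reductions_within_reduction_iff[OF assms] Ball_def
    using assms by blast
  also have "\<dots> \<longleftrightarrow> reductions n C = {C}"
    using self_mem_reductions[OF \<open>C \<noteq> {}\<close>] by blast
  finally show ?thesis
    using \<open>C \<noteq> {}\<close> by (simp add: irreducibles_def)
qed

section \<open>Partitions and supports of sums\<close>

lemma same_partition_image_fst:
  assumes "(ps, qs) \<in> same_partition"
  shows "fst ` set qs = fst ` set ps"
proof -
  obtain f where f: "bij_betw f {..<length ps} {..<length qs}"
    and eq: "\<And>i. i < length ps \<Longrightarrow> fst (ps ! i) = fst (qs ! f i)"
    using assms unfolding same_partition_def by blast
  have set: "fst ` set xs = (\<lambda>i. fst (xs ! i)) ` {..<length xs}" for xs :: "('a \<times> nat) list"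
    by (auto simp: set_conv_nth)
  have "fst ` set qs = (\<lambda>i. fst (qs ! i)) ` f ` {..<length ps}"
    using bij_betw_imp_surj_on[OF f] set[of qs] by simp
  also have "\<dots> = fst ` set ps"
    unfolding image_image set[of ps] using eq by (intro image_cong) auto
  finally show ?thesis .
qed

lemma same_partition_refl: "(ps, ps) \<in> same_partition"
  unfolding same_partition_def by (auto intro!: exI[of _ id])

text \<open>The summands range over the ambient set \<open>B\<close>, so that one family of
  supports, depending only on \<open>a\<close>, serves all members of a chain of subsets at
  once.\<close>

definition sum_supports :: "nat \<Rightarrow> 'a::comm_monoid_add set \<Rightarrow> 'a \<Rightarrow> 'a set set" where
  "sum_supports n B a = {c ` {..<n} | c. (\<forall>i<n. c i \<in> B) \<and> a = (\<Sum>i<n. c i)}"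

lemma nfold_sumset_iff_sum_supports:
  assumes "C \<subseteq> B"
  shows "a \<in> nfold_sumset n C \<longleftrightarrow> (\<exists>s\<in>sum_supports n B a. s \<subseteq> C)"
proof
  assume "a \<in> nfold_sumset n C"
  then obtain c where c: "a = (\<Sum>i<n. c i)" "\<forall>i<n. c i \<in> C"
    unfolding nfold_sumset_def by blast
  with assms have "c ` {..<n} \<in> sum_supports n B a"
    unfolding sum_supports_def by blast
  moreover have "c ` {..<n} \<subseteq> C" using c(2) by auto
  ultimately show "\<exists>s\<in>sum_supports n B a. s \<subseteq> C" by blast
next
  assume "\<exists>s\<in>sum_supports n B a. s \<subseteq> C"
  then obtain c where "a = (\<Sum>i<n. c i)" "c ` {..<n} \<subseteq> C"
    unfolding sum_supports_def by blast
  then show "a \<in> nfold_sumset n C"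
    unfolding nfold_sumset_def by blast
qed

text \<open>Collecting equal summands gives a partition: the multiplicity of \<open>b\<close> is the
  size of the fibre of \<open>c\<close> over \<open>b\<close>. Positivity of \<open>n\<close> keeps
  the list of pairs non-empty.\<close>

lemma sum_support_partition:
  assumes "s \<in> sum_supports n B a" "n > 0"
  obtains ps where "ps \<in> partitions n B a" "fst ` set ps = s"
proof -
  obtain c where c: "s = c ` {..<n}" "\<And>i. i < n \<Longrightarrow> c i \<in> B" "a = (\<Sum>i<n. c i)"
    using assms(1) by (auto simp: sum_supports_def)
  obtain bs where bs: "set bs = s" "distinct bs"
    using finite_distinct_list[of s] c(1) by auto
  let ?fib = "\<lambda>b. {i \<in> {..<n}. c i = b}"
  let ?ps = "map (\<lambda>b. (b, card (?fib b))) bs"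
  \<comment> \<open>The sum over an initial segment of the naturals encodes a multiple of
    \<open>b\<close>. It is rewritten as a constant sum over an arbitrary finite set so that it can
    be matched with the sum over a fibre.\<close>
  have const: "(\<Sum>i<card I. b) = (\<Sum>i\<in>I. b)" if "finite I" for I :: "nat set" and b :: 'a
    using that by (induction I rule: finite_induct) (auto simp: add.commute)
  have "a = (\<Sum>b\<in>s. \<Sum>i\<in>?fib b. c i)"
    using sum.image_gen[of "{..<n}" c c] c by simp
  also have "\<dots> = (\<Sum>b\<in>s. \<Sum>j<card (?fib b). b)"
    by (rule sum.cong[OF refl], subst const, simp, rule sum.cong) auto
  finally have "a = (\<Sum>b\<leftarrow>bs. \<Sum>j<card (?fib b). b)"
    using bs by (simp add: sum_list_distinct_conv_sum_set)
  moreover have "n = (\<Sum>b\<leftarrow>bs. card (?fib b))"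
    using sum.image_gen[of "{..<n}" "\<lambda>_. 1::nat" c] bs c(1)
    by (simp add: sum_list_distinct_conv_sum_set)
  moreover have "bs \<noteq> []" using bs c assms(2) by auto
  moreover have "card (?fib b) > 0" "b \<in> B" if "b \<in> set bs" for b
    using that bs c by (auto simp: card_gt_0_iff)
  ultimately have "?ps \<in> partitions n B a"
    using bs by (simp add: partitions_def o_def)
  moreover have "fst ` set ?ps = s" using bs by (simp add: image_image)
  ultimately show ?thesis using that by blast
qed

lemma finite_sum_supports:
  assumes "finite_partition n B a" "n > 0"
  shows "finite (sum_supports n B a)"
proof (rule finite_surj)
  show "finite (partitions n B a // same_partition)"
    using assms(1) by (simp add: finite_partition_def)
  show "sum_supports n B a \<subseteq> (\<lambda>X. \<Union>qs\<in>X. fst ` set qs) ` (partitions n B a // same_partition)"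
  proof
    fix s assume "s \<in> sum_supports n B a"
    then obtain ps where ps: "ps \<in> partitions n B a" "fst ` set ps = s"
      using sum_support_partition assms(2) by blast
    \<comment> \<open>Equivalent lists have the same support and \<open>ps\<close> belongs to its
      own class, so the union over the class is just this common support. Thus taking supports maps
      the finitely many classes onto a set that includes all of
      \<open>sum_supports n B a\<close>.\<close>
    have "(\<Union>qs\<in>same_partition `` {ps}. fst ` set qs) = s"
      using same_partition_image_fst[of ps] same_partition_refl[of ps] ps(2) by blast
    then show "s \<in> (\<lambda>X. \<Union>qs\<in>X. fst ` set qs) ` (partitions n B a // same_partition)"
      using quotientI[OF ps(1), of same_partition] by blast
  qed
qed

section \<open>Chains of reductions and Zorn's lemma\<close>

lemma Inter_chain_mem_reductions:
  assumes "B \<noteq> {}" "n > 0"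
    and dec: "\<And>b. b \<in> B \<Longrightarrow> finite_decomposition B b"
    and part: "\<And>a. a \<in> nfold_sumset n B \<Longrightarrow> finite_partition n B a"
    and sub: "\<C> \<subseteq> reductions n B" and "\<C> \<noteq> {}"
    and chain: "\<And>C D. C \<in> \<C> \<Longrightarrow> D \<in> \<C> \<Longrightarrow> C \<subseteq> D \<or> D \<subseteq> C"
  shows "\<Inter>\<C> \<in> reductions n B"
proof -
  have red: "C \<subseteq> B" "nfold_sumset n B = nfold_sumset n C" "factor_property B C" if "C \<in> \<C>" for C
    using subsetD[OF sub that] by (simp_all add: mem_reductions_iff)
  have Inter: "\<Inter>\<C> \<subseteq> B" using red(1) \<open>\<C> \<noteq> {}\<close> by blast
  have fac: "factor_property B (\<Inter>\<C>)"
    unfolding factor_property_def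
  proof
    fix b assume b: "b \<in> B"
    \<comment> \<open>A decomposition lies over a subset exactly when its set of entries is
      contained there. The finite family is therefore that of the entry sets of all decompositions
      of \<open>b\<close> in \<open>B\<close>.\<close>
    have "\<exists>s\<in>set ` orderly_decompositions B b. s \<subseteq> \<Inter>\<C>"
    proof (rule finite_subset_of_chain_Inter)
      show "finite (set ` orderly_decompositions B b)"
        using dec[OF b] by (simp add: finite_decomposition_def)
      show "\<exists>s\<in>set ` orderly_decompositions B b. s \<subseteq> C" if C: "C \<in> \<C>" for C
      proof -
        obtain cs where "cs \<noteq> []" "set cs \<subseteq> C" "b = list_product cs"
          using red(3)[OF C] b by (auto simp: factor_property_def)
        then show ?thesis
          using red(1)[OF C] by (auto simp: orderly_decompositions_def)
      qed
    qed (use \<open>\<C> \<noteq> {}\<close> chain in auto)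
    then show "\<exists>cs. cs \<noteq> [] \<and> set cs \<subseteq> \<Inter>\<C> \<and> b = list_product cs"
      by (auto simp: orderly_decompositions_def)
  qed
  have "a \<in> nfold_sumset n (\<Inter>\<C>)" if a: "a \<in> nfold_sumset n B" for a
    unfolding nfold_sumset_iff_sum_supports[OF Inter]
  proof (rule finite_subset_of_chain_Inter)
    show "finite (sum_supports n B a)"
      using finite_sum_supports part[OF a] \<open>n > 0\<close> by blast
    show "\<exists>s\<in>sum_supports n B a. s \<subseteq> C" if "C \<in> \<C>" for C
      using a red(2)[OF that] nfold_sumset_iff_sum_supports[OF red(1)[OF that]] by blast
  qed (use \<open>\<C> \<noteq> {}\<close> chain in auto)
  moreover have "nfold_sumset n (\<Inter>\<C>) \<subseteq> nfold_sumset n B"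
    using Inter unfolding nfold_sumset_def by blast
  \<comment> \<open>A chain of non-empty sets may have empty intersection. Here some
    \<open>b\<close> in \<open>B\<close> is a product of a non-empty list with entries in the
    intersection.\<close>
  moreover have "\<Inter>\<C> \<noteq> {}"
  proof -
    obtain b where "b \<in> B" using \<open>B \<noteq> {}\<close> by blast
    then obtain cs where "cs \<noteq> []" "set cs \<subseteq> \<Inter>\<C>"
      using fac unfolding factor_property_def by blast
    then show ?thesis by (metis set_empty subset_empty)
  qed
  ultimately show ?thesis using fac Inter by (auto simp: mem_reductions_iff)
qed

text \<open>Zorn's lemma yields maximal elements, so it is applied to the complements: unions of
  chains become complements of intersections. The version for non-empty chains is chosen because the
  intersection of the empty family is the whole type, which need not belong to
  \<open>F\<close>.\<close>

lemma inclusion_minimal_exists: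
  fixes F :: "'a set set"
  assumes "F \<noteq> {}"
    and Inter: "\<And>\<C>. \<C> \<subseteq> F \<Longrightarrow> \<C> \<noteq> {} \<Longrightarrow>
      (\<And>C D. C \<in> \<C> \<Longrightarrow> D \<in> \<C> \<Longrightarrow> C \<subseteq> D \<or> D \<subseteq> C) \<Longrightarrow> \<Inter>\<C> \<in> F"
  shows "\<exists>C. inclusion_minimal F C"
proof -
  have "\<exists>M\<in>uminus ` F. \<forall>X\<in>uminus ` F. M \<subseteq> X \<longrightarrow> X = M"
  proof (rule subset_Zorn_nonempty)
    show "uminus ` F \<noteq> {}" using assms(1) by simp
    fix \<D> assume ne: "\<D> \<noteq> {}" and ch: "subset.chain (uminus ` F) \<D>"
    have sub: "\<D> \<subseteq> uminus ` F" and tot: "\<And>X Y. X \<in> \<D> \<Longrightarrow> Y \<in> \<D> \<Longrightarrow> X \<subseteq> Y \<or> Y \<subseteq> X"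
      using ch by (auto simp: subset_chain_def)
    have "\<Inter>(uminus ` \<D>) \<in> F"
    proof (rule Inter)
      show "uminus ` \<D> \<subseteq> F" using sub by auto
      show "C \<subseteq> D \<or> D \<subseteq> C" if "C \<in> uminus ` \<D>" "D \<in> uminus ` \<D>" for C D
        using that tot by auto
    qed (use ne in simp)
    moreover have "\<Union>\<D> = - \<Inter>(uminus ` \<D>)" by auto
    ultimately show "\<Union>\<D> \<in> uminus ` F" by blast
  qed
  then show ?thesis
    unfolding inclusion_minimal_def by auto
qed

theorem theorem2p11:
  fixes B :: "'a::semiring_0 set" and n :: nat
  assumes "\<And>e::'a. (\<forall>a. e * a = a \<and> a * e = a) \<Longrightarrow> 0 \<noteq> e"
    and "B \<noteq> {}"
    and "n \<ge> 2"
    and "\<forall>b\<in>B. finite_decomposition B b"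
    and "\<forall>a\<in>nfold_sumset n B. finite_partition n B a"
  shows "(\<exists>C. inclusion_minimal (reductions n B) C) \<and>
    reductions n B \<inter> irreducibles n \<noteq> {} \<and>
    (\<forall>C\<in>reductions n B.
       inclusion_minimal (reductions n B) C \<longleftrightarrow> C \<in> reductions n B \<inter> irreducibles n)"
proof -
  have "\<exists>C. inclusion_minimal (reductions n B) C"
  proof (rule inclusion_minimal_exists)
    show "reductions n B \<noteq> {}" using self_mem_reductions[OF assms(2)] by blast
    show "\<Inter>\<C> \<in> reductions n B"
      if "\<C> \<subseteq> reductions n B" "\<C> \<noteq> {}" "\<And>C D. C \<in> \<C> \<Longrightarrow> D \<in> \<C> \<Longrightarrow> C \<subseteq> D \<or> D \<subseteq> C"
      for \<C>
      using assms that by (intro Inter_chain_mem_reductions) auto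
  qed
  \<comment> \<open>By the equivalence of minimality and irreducibility within
    \<open>reductions n B\<close>, the minimal element just found also witnesses the non-empty
    intersection.\<close>
  moreover have "C \<in> reductions n B" if "inclusion_minimal (reductions n B) C" for C
    using that by (simp add: inclusion_minimal_def)
  ultimately show ?thesis
    using inclusion_minimal_reductions_iff by blast
qed

end
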